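(* Let $G$ be a finite connected simple graph with minimum degree $\delta(G)\ge 2$ that is not isomorphic to the $4$-cycle $C_4$. Then $FD(G)>2$.
   Context: A set $D\subseteq V(G)$ is dominating if every vertex not in $D$ has a neighbour in $D$. For positive integers $k,s$, a $(k,s)$-configuration of $G$ is a multiset of $k$ (not necessarily distinct) dominating sets of $G$ such that every vertex belongs to at most $s$ of them. The fractional domatic number $FD(G)$ is the maximum of $k/s$ over all $(k,s)$ for which $G$ admits a $(k,s)$-configuration. *)

theory Defs
  imports "Graph_Theory.Graph_Theory" "HOL-Library.Multiset" Complex_Main
begin

text \<open>
  A finite simple graph is a \<open>graph\<close> in the sense of \<open>Graph_Theory\<close>: a finite symmetric digraph
  without loops and parallel arcs, each undirected edge being a pair of opposite arcs. Hence the
  degree of a vertex is its out-degree.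
\<close>

definition min_degree :: "('a,'b) pre_digraph \<Rightarrow> nat" where
  "min_degree G = Min (out_degree G ` verts G)"

text \<open>The cycle on the vertices \<open>0, \<dots>, n - 1\<close>, meaningful for \<open>n \<ge> 3\<close>.\<close>

definition cycle_graph :: "nat \<Rightarrow> (nat, nat \<times> nat) pre_digraph" where
  "cycle_graph n = with_proj \<lparr> pverts = {..<n},
     parcs = {(i, j). i < n \<and> j < n \<and> (j = (i + 1) mod n \<or> i = (j + 1) mod n)} \<rparr>"

definition dominating_set :: "('a,'b) pre_digraph \<Rightarrow> 'a set \<Rightarrow> bool" where
  "dominating_set G D \<longleftrightarrow> D \<subseteq> verts G \<and> (\<forall>v \<in> verts G - D. \<exists>u \<in> D. v \<rightarrow>\<^bsub>G\<^esub> u)"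

definition configuration :: "('a,'b) pre_digraph \<Rightarrow> nat \<Rightarrow> nat \<Rightarrow> 'a set multiset \<Rightarrow> bool" where
  "configuration G k s M \<longleftrightarrow> k > 0 \<and> s > 0 \<and> size M = k \<and>
     (\<forall>D \<in># M. dominating_set G D) \<and>
     (\<forall>v \<in> verts G. size {#D \<in># M. v \<in> D#} \<le> s)"

definition configuration_ratios :: "('a,'b) pre_digraph \<Rightarrow> real set" where
  "configuration_ratios G = {real k / real s | k s. \<exists>M. configuration G k s M}"

definition fractional_domatic_number :: "('a,'b) pre_digraph \<Rightarrow> real" where
  "fractional_domatic_number G = (GREATEST r. r \<in> configuration_ratios G)"

text \<open>
  The maximum exists for every finite nonempty graph. By Dickson's lemma, among infinitely many
  configurations with increasing ratios one is contained in a later one, with room to spare at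
  every vertex; the difference is a smaller configuration with a larger ratio.
\<close>

lemma nat_seq_mono_subseq:
  fixes a :: "nat \<Rightarrow> nat"
  shows "\<exists>r :: nat \<Rightarrow> nat. strict_mono r \<and> mono (\<lambda>n. a (r n))"
proof -
  obtain r :: "nat \<Rightarrow> nat" where r: "strict_mono r" "monoseq (\<lambda>n. a (r n))"
    using seq_monosub by blast
  show ?thesis
  proof (cases "mono (\<lambda>n. a (r n))")
    case True
    then show ?thesis using r by blast
  next
    case False
    then have dec: "\<And>m n. m \<le> n \<Longrightarrow> a (r n) \<le> a (r m)"
      using r(2) unfolding monoseq_def mono_def by blast
    obtain N where N: "\<And>n. a (r N) \<le> a (r n)"
      using ex_has_least_nat[of "\<lambda>_. True" 0 "\<lambda>n. a (r n)"] by auto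
    have eq: "a (r (n + N)) = a (r N)" for n
      using dec[of N "n + N"] N[of "n + N"] by simp
    have "strict_mono (\<lambda>n. r (n + N))"
      using r(1) by (auto simp: strict_mono_def)
    moreover have "mono (\<lambda>n. a (r (n + N)))"
      by (simp add: eq mono_def)
    ultimately show ?thesis by blast
  qed
qed

lemma dickson_subseq:
  fixes f :: "nat \<Rightarrow> 'i \<Rightarrow> nat"
  assumes "finite I"
  shows "\<exists>r :: nat \<Rightarrow> nat. strict_mono r \<and> (\<forall>i \<in> I. mono (\<lambda>n. f (r n) i))"
  using assms
proof (induction I)
  case empty
  have "strict_mono (\<lambda>n::nat. n)" by (simp add: strict_mono_def)
  then show ?case by blast
next
  case (insert x I)
  then obtain r :: "nat \<Rightarrow> nat" where r: "strict_mono r" "\<And>i. i \<in> I \<Longrightarrow> mono (\<lambda>n. f (r n) i)" by blast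
  obtain q :: "nat \<Rightarrow> nat" where q: "strict_mono q" "mono (\<lambda>n. f (r (q n)) x)"
    using nat_seq_mono_subseq[of "\<lambda>n. f (r n) x"] by blast
  have "strict_mono (\<lambda>n. r (q n))" using r(1) q(1) by (simp add: strict_mono_def)
  moreover have "mono (\<lambda>n. f (r (q n)) i)" if "i \<in> I" for i
    using r(2)[OF that] q(1) by (simp add: mono_def strict_mono_less_eq)
  ultimately show ?case using q(2) by blast
qed

lemma configuration_diff:
  assumes V: "verts G \<noteq> {}"
    and x: "configuration G k s M" and y: "configuration G l t N"
    and sub: "\<And>D. D \<in> Pow (verts G) \<Longrightarrow> count M D \<le> count N D"
    and slack: "\<And>v. v \<in> verts G \<Longrightarrow>
      s - size {#D \<in># M. v \<in> D#} \<le> t - size {#D \<in># N. v \<in> D#}"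
    and ratio: "real k / real s < real l / real t"
  shows "\<exists>l' t' N'. configuration G l' t' N' \<and> t' < t \<and> real l / real t < real l' / real t'"
proof -
  have pos: "k > 0" "s > 0" "l > 0" "t > 0"
    and size: "size M = k" "size N = l"
    and dom: "\<And>D. D \<in># M \<Longrightarrow> dominating_set G D" "\<And>D. D \<in># N \<Longrightarrow> dominating_set G D"
    and load: "\<And>v. v \<in> verts G \<Longrightarrow> size {#D \<in># M. v \<in> D#} \<le> s"
      "\<And>v. v \<in> verts G \<Longrightarrow> size {#D \<in># N. v \<in> D#} \<le> t"
    using x y by (auto simp: configuration_def)
  have MN: "M \<subseteq># N"
  proof (rule mset_subset_eqI)
    fix D
    show "count M D \<le> count N D"
    proof (cases "D \<in># M")
      case True
      then show ?thesis using dom(1) sub by (auto simp: dominating_set_def)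
    next
      case False
      then show ?thesis by (simp add: not_in_iff)
    qed
  qed
  have part: "size {#D \<in># N. v \<in> D#} = size {#D \<in># M. v \<in> D#} + size {#D \<in># N - M. v \<in> D#}" for v
    by (metis MN filter_union_mset size_union subset_mset.add_diff_inverse)
  have diff: "size {#D \<in># N - M. v \<in> D#} + s \<le> t" if "v \<in> verts G" for v
    using slack[OF that] load(1)[OF that] load(2)[OF that] part[of v] by linarith
  have "s \<le> t" using V diff by fastforce
  have size_diff: "size (N - M) = l - k" "k \<le> l"
    using MN size by (auto simp: size_Diff_submset size_mset_mono)
  have cross: "real k * real t < real l * real s"
    using ratio pos by (simp add: field_simps)
  have "s \<noteq> t"
  proof
    assume "s = t"
    have "N - M = {#}"
    proof (rule ccontr)
      assume "N - M \<noteq> {#}"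
      then obtain D where D: "D \<in># N - M" by blast
      then have "dominating_set G D" using dom(2) in_diffD by fastforce
      then obtain v where v: "v \<in> D" "v \<in> verts G"
        using V by (fastforce simp: dominating_set_def)
      with D have "D \<in># {#D \<in># N - M. v \<in> D#}" by (simp del: filter_diff_mset)
      then have "size {#D \<in># N - M. v \<in> D#} \<noteq> 0" by auto
      then show False using diff[OF v(2)] \<open>s = t\<close> by linarith
    qed
    then have "k = l" using size_diff by simp
    then show False using ratio \<open>s = t\<close> by simp
  qed
  then have st: "s < t" using \<open>s \<le> t\<close> by simp
  have "real l * real (t - s) < real (l - k) * real t"
    using cross st size_diff(2) by (simp add: of_nat_diff algebra_simps)
  then have better: "real l / real t < real (l - k) / real (t - s)"
    using st pos by (simp add: field_simps)
  have "l - k > 0"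
  proof (rule ccontr)
    assume "\<not> l - k > 0"
    then have "real l / real t < 0" using better by simp
    then show False by (simp add: divide_less_0_iff)
  qed
  moreover have "dominating_set G D" if "D \<in># N - M" for D
    using dom(2) that in_diffD by fastforce
  moreover have "size {#D \<in># N - M. v \<in> D#} \<le> t - s" if "v \<in> verts G" for v
    using diff[OF that] by linarith
  ultimately have "configuration G (l - k) (t - s) (N - M)"
    using st size_diff unfolding configuration_def by auto
  then show ?thesis using better st pos by (metis diff_less)
qed

lemma configuration_ratios_has_max:
  assumes fin: "finite (verts G)" and V: "verts G \<noteq> {}"
  shows "\<exists>r \<in> configuration_ratios G. \<forall>q \<in> configuration_ratios G. q \<le> r"
proof (rule ccontr)
  assume "\<not> ?thesis"
  then have nomax: "\<And>r. r \<in> configuration_ratios G \<Longrightarrow> \<exists>q \<in> configuration_ratios G. r < q"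
    by force
  define conf where "conf = (\<lambda>(k, s, M). configuration G k s M)"
  define rate where "rate = (\<lambda>(k :: nat, s :: nat, M :: 'a set multiset). real k / real s)"
  define cap where "cap = (\<lambda>(k :: nat, s :: nat, M :: 'a set multiset). s)"
  have next_ex: "\<exists>y. conf y \<and> rate x < rate y \<and> (\<forall>z. conf z \<and> rate x < rate z \<longrightarrow> cap y \<le> cap z)"
    if "conf x" for x
  proof -
    have "rate x \<in> configuration_ratios G"
      using that by (auto simp: conf_def rate_def configuration_ratios_def)
    from nomax[OF this] have "\<exists>y. conf y \<and> rate x < rate y"
      by (auto simp: conf_def rate_def configuration_ratios_def)
    then show ?thesis
      using ex_has_least_nat[of "\<lambda>y. conf y \<and> rate x < rate y" _ cap] by blast
  qed
  have "conf (1, 1, {#verts G#})"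
    by (simp add: conf_def configuration_def dominating_set_def)
  then obtain x where x: "\<And>n. conf (x n)" "\<And>n. rate (x n) < rate (x (Suc n))"
      "\<And>n z. conf z \<Longrightarrow> rate (x n) < rate z \<Longrightarrow> cap (x (Suc n)) \<le> cap z"
    using dependent_nat_choice[of "\<lambda>_. conf"
        "\<lambda>_ x y. rate x < rate y \<and> (\<forall>z. conf z \<and> rate x < rate z \<longrightarrow> cap y \<le> cap z)"]
      next_ex by metis
  define enc where "enc = (\<lambda>(k :: nat, s :: nat, M :: 'a set multiset).
    case_sum (\<lambda>D. count M D) (\<lambda>v. s - size {#D \<in># M. v \<in> D#}))"
  have "finite (Pow (verts G) <+> verts G)" using fin by simp
  from dickson_subseq[OF this, of "\<lambda>n. enc (x (Suc n))"]
  obtain r :: "nat \<Rightarrow> nat" where r: "strict_mono r"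
      "\<And>i. i \<in> Pow (verts G) <+> verts G \<Longrightarrow> mono (\<lambda>n. enc (x (Suc (r n))) i)"
    by blast
  define i j where "i = Suc (r 0)" and "j = r 1"
  have "i < Suc j" using r(1) by (simp add: i_def j_def strict_mono_def)
  then have lt: "rate (x i) < rate (x (Suc j))"
    using lift_Suc_mono_less[of "\<lambda>n. rate (x n)"] x(2) by blast
  have enc_le: "enc (x i) u \<le> enc (x (Suc j)) u" if "u \<in> Pow (verts G) <+> verts G" for u
    using monoD[OF r(2)[OF that], of 0 1] by (simp add: i_def j_def)
  obtain k s M where xi: "x i = (k, s, M)" by (cases "x i") auto
  obtain l t N where xj: "x (Suc j) = (l, t, N)" by (cases "x (Suc j)") auto
  have "\<exists>l' t' N'. configuration G l' t' N' \<and> t' < t \<and> real l / real t < real l' / real t'"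
  proof (rule configuration_diff[OF V])
    show "configuration G k s M" "configuration G l t N"
      using x(1)[of i] x(1)[of "Suc j"] by (simp_all add: xi xj conf_def)
    show "count M D \<le> count N D" if "D \<in> Pow (verts G)" for D
      using enc_le[OF InlI[OF that]] by (simp add: xi xj enc_def)
    show "s - size {#D \<in># M. v \<in> D#} \<le> t - size {#D \<in># N. v \<in> D#}" if "v \<in> verts G" for v
      using enc_le[OF InrI[OF that]] by (simp add: xi xj enc_def)
    show "real k / real s < real l / real t"
      using lt by (simp add: xi xj rate_def)
  qed
  then obtain l' t' N' where z: "configuration G l' t' N'" "t' < t"
    "real l / real t < real l' / real t'" by blast
  have "rate (x j) < rate (l', t', N')"
    using x(2)[of j] z(3) by (simp add: xj rate_def)
  then have "cap (x (Suc j)) \<le> cap (l', t', N')"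
    using x(3) z(1) by (simp add: conf_def)
  then show False using z(2) by (simp add: xj cap_def)
qed

lemma fractional_domatic_number_is_max:
  assumes "finite (verts G)" "verts G \<noteq> {}"
  shows "fractional_domatic_number G \<in> configuration_ratios G"
    and "\<And>q. q \<in> configuration_ratios G \<Longrightarrow> q \<le> fractional_domatic_number G"
proof -
  obtain r where r: "r \<in> configuration_ratios G" "\<And>q. q \<in> configuration_ratios G \<Longrightarrow> q \<le> r"
    using configuration_ratios_has_max[OF assms] by blast
  have "fractional_domatic_number G = r"
    unfolding fractional_domatic_number_def by (rule Greatest_equality) (use r in auto)
  with r show "fractional_domatic_number G \<in> configuration_ratios G"
    and "\<And>q. q \<in> configuration_ratios G \<Longrightarrow> q \<le> fractional_domatic_number G" by auto
qed

end

theory Submission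
  imports Defs
begin

text \<open>
  Let \<open>e\<^sub>v\<close> be the unit vector at \<open>v\<close>. To a multiset of dominating sets, assign the vector whose
  entry at \<open>v\<close> is the number of members containing \<open>v\<close> minus the number of members avoiding
  \<open>v\<close>. Such vectors are closed under addition, and \<open>FD(G) > 2\<close> follows once one has only negative
  entries.

  If a star with centre \<open>c\<close> and leaf set \<open>L\<close> can be deleted without leaving isolated vertices, the
  rest splits into two disjoint dominating sets; adding the centre to both, or the leaves to both,
  gives \<open>\<plusminus> 2 (e\<^sub>c - \<Sum>\<^sub>L e\<^sub>l)\<close>. For an edge \<open>xy\<close> let \<open>Z\<close> be the set of vertices with
  neighbourhood \<open>{x, y}\<close>. The stars with centre \<open>x\<close> and leaves \<open>Z \<union> {y}\<close>, and with centre \<open>y\<close>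
  and leaves \<open>Z \<union> {x}\<close>, can be deleted; their difference is \<open>4 (e\<^sub>x - e\<^sub>y)\<close>, so by connectedness
  mass can be moved between any two vertices. A deletable star with at least two leaves then yields a
  negative vector, and the only graph without such a star is \<open>C\<^sub>4\<close>.
\<close>

section \<open>Excess vectors of multisets of dominating sets\<close>

definition excess_bound :: "('a,'b) pre_digraph \<Rightarrow> ('a \<Rightarrow> int) \<Rightarrow> bool" where
  "excess_bound G f \<longleftrightarrow> (\<exists>M. (\<forall>D \<in># M. dominating_set G D) \<and>
     (\<forall>v \<in> verts G. 2 * int (size {#D \<in># M. v \<in> D#}) - int (size M) \<le> f v))"

definition deletable_star :: "('a,'b) pre_digraph \<Rightarrow> 'a \<Rightarrow> 'a set \<Rightarrow> bool" where
  "deletable_star G c L \<longleftrightarrow> c \<in> verts G \<and> L \<subseteq> verts G \<and> L \<noteq> {} \<and> (\<forall>l \<in> L. c \<rightarrow>\<^bsub>G\<^esub> l) \<and>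
     (\<forall>t \<in> verts G - insert c L. \<exists>u \<in> verts G - insert c L. t \<rightarrow>\<^bsub>G\<^esub> u)"

text \<open>This is why \<open>excess_bound\<close> asks for an inequality: surplus negative entries
  may be rounded up to 0, as happens when a large star is reduced to one negative entry.\<close>

lemma excess_bound_mono:
  assumes "excess_bound G f" "\<And>v. v \<in> verts G \<Longrightarrow> f v \<le> g v"
  shows "excess_bound G g"
  using assms unfolding excess_bound_def by (meson order_trans)

lemma excess_bound_zero: "excess_bound G (\<lambda>_. 0)"
  unfolding excess_bound_def by (rule exI[of _ "{#}"]) simp

lemma excess_bound_add:
  assumes "excess_bound G f" "excess_bound G g"
  shows "excess_bound G (\<lambda>v. f v + g v)"
proof -
  obtain M N where
    "\<forall>D \<in># M. dominating_set G D"
    "\<forall>v \<in> verts G. 2 * int (size {#D \<in># M. v \<in> D#}) - int (size M) \<le> f v"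
    "\<forall>D \<in># N. dominating_set G D"
    "\<forall>v \<in> verts G. 2 * int (size {#D \<in># N. v \<in> D#}) - int (size N) \<le> g v"
    using assms unfolding excess_bound_def by blast
  then show ?thesis
    unfolding excess_bound_def by (intro exI[of _ "M + N"]) (fastforce simp: algebra_simps)
qed

lemma excess_bound_sum:
  assumes "finite A" "\<And>a. a \<in> A \<Longrightarrow> excess_bound G (f a)"
  shows "excess_bound G (\<lambda>v. \<Sum>a \<in> A. f a v)"
  using assms
proof (induction A)
  case empty
  then show ?case by (simp add: excess_bound_zero)
next
  case (insert a A)
  then show ?case using excess_bound_add[of G "f a" "\<lambda>v. \<Sum>a \<in> A. f a v"] by simp
qed

lemma excess_bound_pair:
  assumes "dominating_set G A" "dominating_set G B"
    and "\<And>v. v \<in> verts G \<Longrightarrow> 2 * (of_bool (v \<in> A) + of_bool (v \<in> B)) - 2 \<le> f v"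
  shows "excess_bound G f"
  unfolding excess_bound_def
proof (intro exI[of _ "{#A, B#}"] conjI ballI)
  fix v assume "v \<in> verts G"
  then show "2 * int (size {#D \<in># {#A, B#}. v \<in> D#}) - int (size {#A, B#}) \<le> f v"
    using assms(3)[of v] by (auto simp: of_bool_def split: if_splits)
qed (use assms in auto)

lemma configuration_ratio_gt_2:
  assumes "excess_bound G (\<lambda>_. - 4)" and V: "verts G \<noteq> {}"
  shows "\<exists>r \<in> configuration_ratios G. r > 2"
proof -
  obtain M where dom: "\<forall>D \<in># M. dominating_set G D"
    and load: "\<And>v. v \<in> verts G \<Longrightarrow> 2 * int (size {#D \<in># M. v \<in> D#}) - int (size M) \<le> - 4"
    using assms(1) unfolding excess_bound_def by blast
  \<comment> \<open>With m = \<open>size M\<close>, every load is at most (m - 4) / 2 and hence at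
    most \<open>s\<close>. As some vertex exists, m is at least 4, which makes \<open>s\<close>
    positive; and 2 \<open>s\<close> is at most m - 2, which puts the ratio above 2.\<close>
  define s where "s = (size M - 2) div 2"
  have "size M \<ge> 4" using load V by fastforce
  then have s: "s > 0" "2 * s < size M" unfolding s_def by linarith+
  have "size {#D \<in># M. v \<in> D#} \<le> s" if "v \<in> verts G" for v
    using load[OF that] unfolding s_def by linarith
  then have "configuration G (size M) s M"
    using dom s unfolding configuration_def by auto
  moreover have "real (size M) / real s > 2" using s by (simp add: field_simps)
  ultimately show ?thesis unfolding configuration_ratios_def by blast
qed

section \<open>Deletable stars\<close>

context graph
begin

lemma adj_sym: "u \<rightarrow>\<^bsub>G\<^esub> v \<Longrightarrow> v \<rightarrow>\<^bsub>G\<^esub> u"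
  using arcs_ends_symmetric[OF sym_arcs] .

text \<open>Ore's argument: a maximal independent subset of \<open>H\<close> dominates
  \<open>H\<close> by maximality. Its complement in \<open>H\<close> dominates too, because each
  member of the independent set has a neighbour in \<open>H\<close>, which independence keeps
  outside the set.\<close>

lemma ex_domatic_split:
  assumes H: "H \<subseteq> verts G" and iso: "\<And>t. t \<in> H \<Longrightarrow> \<exists>u \<in> H. t \<rightarrow>\<^bsub>G\<^esub> u"
  obtains I where "I \<subseteq> H" "\<And>v. v \<in> H - I \<Longrightarrow> \<exists>u \<in> I. v \<rightarrow>\<^bsub>G\<^esub> u" "\<And>v. v \<in> I \<Longrightarrow> \<exists>u \<in> H - I. v \<rightarrow>\<^bsub>G\<^esub> u"
proof -
  define indep where "indep = {I. I \<subseteq> H \<and> (\<forall>u \<in> I. \<forall>v \<in> I. \<not> u \<rightarrow>\<^bsub>G\<^esub> v)}"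
  have "finite indep" unfolding indep_def
    using finite_subset[OF H] by simp
  moreover have "{} \<in> indep" by (simp add: indep_def)
  ultimately obtain I where I: "I \<in> indep" and max: "\<And>J. J \<in> indep \<Longrightarrow> I \<subseteq> J \<Longrightarrow> I = J"
    using finite_has_maximal[of indep] by blast
  show ?thesis
  proof
    show "I \<subseteq> H" using I by (simp add: indep_def)
    show "\<exists>u \<in> I. v \<rightarrow>\<^bsub>G\<^esub> u" if "v \<in> H - I" for v
    proof (rule ccontr)
      assume "\<not> (\<exists>u \<in> I. v \<rightarrow>\<^bsub>G\<^esub> u)"
      then have "insert v I \<in> indep"
        using I that adj_sym adj_not_same unfolding indep_def by blast
      then show False using max[of "insert v I"] that by blast
    qed
    show "\<exists>u \<in> H - I. v \<rightarrow>\<^bsub>G\<^esub> u" if "v \<in> I" for v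
      using iso[of v] I that unfolding indep_def by blast
  qed
qed

text \<open>The centre dominates the leaves, and the leaves, being nonempty, dominate the centre. So
  either of them completes both halves of the split of the rest to dominating sets. A vertex of the
  rest lies in exactly one of the two sets and gets entry 0.\<close>

lemma deletable_star_excess:
  assumes "deletable_star G c L"
  shows "excess_bound G (\<lambda>v. 2 * (of_bool (v = c) - of_bool (v \<in> L)))"
    and "excess_bound G (\<lambda>v. 2 * (of_bool (v \<in> L) - of_bool (v = c)))"
proof -
  let ?H = "verts G - insert c L"
  have star: "c \<in> verts G" "L \<subseteq> verts G" "L \<noteq> {}" "\<And>l. l \<in> L \<Longrightarrow> c \<rightarrow>\<^bsub>G\<^esub> l" "\<And>l. l \<in> L \<Longrightarrow> l \<rightarrow>\<^bsub>G\<^esub> c"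
    "\<And>t. t \<in> ?H \<Longrightarrow> \<exists>u \<in> ?H. t \<rightarrow>\<^bsub>G\<^esub> u"
    using assms adj_sym unfolding deletable_star_def by auto
  have "c \<notin> L" using star(4) adj_not_same by blast
  obtain I where I: "I \<subseteq> ?H" "\<And>v. v \<in> ?H - I \<Longrightarrow> \<exists>u \<in> I. v \<rightarrow>\<^bsub>G\<^esub> u" "\<And>v. v \<in> I \<Longrightarrow> \<exists>u \<in> ?H - I. v \<rightarrow>\<^bsub>G\<^esub> u"
    using ex_domatic_split[of ?H] star(6) by blast
  have dom: "dominating_set G (A \<union> J)"
    if A: "A \<subseteq> insert c L" "\<And>v. v \<in> insert c L - A \<Longrightarrow> \<exists>u \<in> A. v \<rightarrow>\<^bsub>G\<^esub> u"
      and J: "J \<subseteq> ?H" "\<And>v. v \<in> ?H - J \<Longrightarrow> \<exists>u \<in> J. v \<rightarrow>\<^bsub>G\<^esub> u" for A J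
    unfolding dominating_set_def
  proof (intro conjI ballI)
    show "A \<union> J \<subseteq> verts G" using A(1) J(1) star(1,2) by blast
    fix v assume "v \<in> verts G - (A \<union> J)"
    then show "\<exists>u \<in> A \<union> J. v \<rightarrow>\<^bsub>G\<^esub> u"
      using A(2)[of v] J(2)[of v] by (cases "v \<in> insert c L") auto
  qed
  have compl: "\<exists>u \<in> ?H - I. v \<rightarrow>\<^bsub>G\<^esub> u" if "v \<in> ?H - (?H - I)" for v
    using I(3)[of v] that by blast
  have centre: "dominating_set G ({c} \<union> I)" "dominating_set G ({c} \<union> (?H - I))"
    by (rule dom; (rule I(1) | erule I(2) | erule compl | use star(5) in blast))+
  have leaves: "dominating_set G (L \<union> I)" "dominating_set G (L \<union> (?H - I))"
    by (rule dom; (rule I(1) | erule I(2) | erule compl | use star(3,4) in blast))+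
  show "excess_bound G (\<lambda>v. 2 * (of_bool (v = c) - of_bool (v \<in> L)))"
    by (rule excess_bound_pair[OF centre]) (use I(1) \<open>c \<notin> L\<close> in auto)
  show "excess_bound G (\<lambda>v. 2 * (of_bool (v \<in> L) - of_bool (v = c)))"
    by (rule excess_bound_pair[OF leaves]) (use I(1) \<open>c \<notin> L\<close> in auto)
qed

text \<open>\<open>T\<close> collects the vertices that deleting the star would isolate. Making them
  leaves isolates nothing new: a remaining vertex has a neighbour outside the star, and that
  neighbour is not in \<open>T\<close>, since it has a neighbour outside the star itself.\<close>

lemma deletable_star_absorb:
  assumes "L \<noteq> {}" "\<And>l. l \<in> L \<Longrightarrow> c \<rightarrow>\<^bsub>G\<^esub> l"
    and T: "T = {t \<in> verts G - insert c L. \<forall>u. t \<rightarrow>\<^bsub>G\<^esub> u \<longrightarrow> u \<in> insert c L}"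
    and "\<And>t. t \<in> T \<Longrightarrow> t \<rightarrow>\<^bsub>G\<^esub> c"
  shows "deletable_star G c (L \<union> T)"
proof -
  have "\<exists>u \<in> verts G - insert c (L \<union> T). t \<rightarrow>\<^bsub>G\<^esub> u" if t: "t \<in> verts G - insert c (L \<union> T)" for t
  proof -
    obtain u where u: "t \<rightarrow>\<^bsub>G\<^esub> u" "u \<notin> insert c L" using t unfolding T by blast
    then have "u \<notin> T" using adj_sym t unfolding T by blast
    then show ?thesis using u adj_in_verts by blast
  qed
  moreover have "c \<rightarrow>\<^bsub>G\<^esub> l" if "l \<in> L \<union> T" for l
    using that assms adj_sym by blast
  moreover have "c \<in> verts G" using assms(1,2) adj_in_verts by blast
  moreover have "L \<union> T \<subseteq> verts G" using assms(2) adj_in_verts unfolding T by blast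
  ultimately show ?thesis using assms(1) unfolding deletable_star_def by blast
qed

section \<open>Moving mass and using a large star\<close>

lemma min_degree_ex_neighbour:
  assumes "min_degree G \<ge> 2" "v \<in> verts G"
  shows "\<exists>w. w \<noteq> u \<and> v \<rightarrow>\<^bsub>G\<^esub> w"
proof -
  have "2 \<le> out_degree G v"
    using assms order_trans[OF _ Min_le] unfolding min_degree_def by (metis finite_imageI finite_verts imageI)
  then have "\<not> is_singleton (out_arcs G v)" "out_arcs G v \<noteq> {}"
    unfolding out_degree_def is_singleton_altdef by auto
  then obtain e e' where e: "e \<in> out_arcs G v" "e' \<in> out_arcs G v" "e \<noteq> e'"
    by (metis is_singletonI' ex_in_conv)
  then have "head G e \<noteq> head G e'"
    using no_multi_arcs[of e e'] by (auto simp: arc_to_ends_def)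
  moreover have "v \<rightarrow>\<^bsub>G\<^esub> head G e" "v \<rightarrow>\<^bsub>G\<^esub> head G e'"
    using e by (auto intro!: dominatesI simp: arc_to_ends_def)
  ultimately show ?thesis by metis
qed

lemma edge_excess:
  assumes deg: "min_degree G \<ge> 2" and xy: "x \<rightarrow>\<^bsub>G\<^esub> y"
  shows "excess_bound G (\<lambda>v. 4 * (of_bool (v = x) - of_bool (v = y)))"
proof -
  define Z where "Z = {t \<in> verts G - {x, y}. \<forall>u. t \<rightarrow>\<^bsub>G\<^esub> u \<longrightarrow> u \<in> {x, y}}"
  \<comment> \<open>All neighbours of \<open>t\<close> lie in \<open>{x, y}\<close>; one differing
    from \<open>x\<close> must be \<open>y\<close>, and conversely.\<close>
  have adj: "t \<rightarrow>\<^bsub>G\<^esub> x" "t \<rightarrow>\<^bsub>G\<^esub> y" if "t \<in> Z" for t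
    using min_degree_ex_neighbour[OF deg, of t x] min_degree_ex_neighbour[OF deg, of t y] that
    unfolding Z_def by blast+
  have "deletable_star G x ({y} \<union> Z)"
    by (rule deletable_star_absorb) (use xy adj in \<open>auto simp: Z_def\<close>)
  moreover have "deletable_star G y ({x} \<union> Z)"
    by (rule deletable_star_absorb) (use adj_sym[OF xy] adj in \<open>auto simp: Z_def\<close>)
  ultimately have "excess_bound G (\<lambda>v. 2 * (of_bool (v = x) - of_bool (v \<in> {y} \<union> Z)) +
      2 * (of_bool (v \<in> {x} \<union> Z) - of_bool (v = y)))"
    using deletable_star_excess excess_bound_add by blast
  \<comment> \<open>On \<open>Z\<close> the entries -2 and 2 cancel, while \<open>x\<close> and
    \<open>y\<close> receive 4 and -4.\<close>
  then show ?thesis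
    by (rule excess_bound_mono) (use xy adj_not_same in \<open>auto simp: Z_def\<close>)
qed

text \<open>The edge vectors telescope along a walk.\<close>

lemma reachable_excess:
  assumes deg: "min_degree G \<ge> 2" and "x \<rightarrow>\<^sup>*\<^bsub>G\<^esub> y"
  shows "excess_bound G (\<lambda>v. 4 * (of_bool (v = x) - of_bool (v = y)))"
  using assms(2)
proof (induction rule: reachable_induct)
  case base
  show ?case by (simp add: excess_bound_zero)
next
  case (step y z)
  from excess_bound_add[OF step.IH edge_excess[OF deg step.hyps(2)]]
  show ?case by (rule excess_bound_mono) simp
qed

lemma large_star_excess:
  assumes deg: "min_degree G \<ge> 2" and conn: "\<And>u v. u \<in> verts G \<Longrightarrow> v \<in> verts G \<Longrightarrow> u \<rightarrow>\<^sup>*\<^bsub>G\<^esub> v"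
    and star: "deletable_star G c L" and ab: "a \<in> L" "b \<in> L" "a \<noteq> b"
  shows "excess_bound G (\<lambda>_. - 4)"
proof -
  have in_verts: "a \<in> verts G" "b \<in> verts G" "c \<in> verts G"
    using star ab unfolding deletable_star_def by auto
  \<comment> \<open>Doubling matches the entries 4 of the transport vectors.\<close>
  note twice = excess_bound_add[OF deletable_star_excess(1)[OF star] deletable_star_excess(1)[OF star]]
  \<comment> \<open>Moving 4 from \<open>c\<close> to \<open>a\<close> cancels both entries and
    leaves -4 on the other leaves, among them \<open>b\<close>.\<close>
  have gain: "excess_bound G (\<lambda>v. - 4 * of_bool (v = b))"
    using excess_bound_add[OF twice reachable_excess[OF deg conn[OF in_verts(1,3)]]]
    by (rule excess_bound_mono) (use ab in auto)
  \<comment> \<open>Now the deficit is shifted from \<open>b\<close> to an arbitrary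
    \<open>w\<close>; summing over all \<open>w\<close> puts -4 everywhere.\<close>
  have "excess_bound G (\<lambda>v. - 4 * of_bool (v = w))" if "w \<in> verts G" for w
    using excess_bound_add[OF gain reachable_excess[OF deg conn[OF in_verts(2) that]]]
    by (rule excess_bound_mono) simp
  then have "excess_bound G (\<lambda>v. \<Sum>w \<in> verts G. - 4 * of_bool (v = w))"
    by (intro excess_bound_sum) auto
  moreover have "(\<Sum>w \<in> verts G. - 4 * of_bool (v = w)) = (- 4 :: int)" if "v \<in> verts G" for v
    unfolding sum_distrib_left[symmetric] of_bool_def sum.delta[OF finite_verts] using that by simp
  ultimately show ?thesis
    by (auto elim: excess_bound_mono)
qed

section \<open>Graphs without a large deletable star\<close>

lemma no_large_star_opposite:
  assumes deg: "min_degree G \<ge> 2"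
    and no_star: "\<nexists>c L a b. deletable_star G c L \<and> a \<in> L \<and> b \<in> L \<and> a \<noteq> b"
    and path: "y \<rightarrow>\<^bsub>G\<^esub> a" "y \<rightarrow>\<^bsub>G\<^esub> b" "a \<noteq> b"
  shows "\<exists>t \<in> verts G. t \<noteq> y \<and> (\<forall>u. t \<rightarrow>\<^bsub>G\<^esub> u \<longleftrightarrow> u = a \<or> u = b)"
proof -
  define T where "T = {t \<in> verts G - {y, a, b}. \<forall>u. t \<rightarrow>\<^bsub>G\<^esub> u \<longrightarrow> u \<in> {y, a, b}}"
  \<comment> \<open>If every vertex isolated by deleting \<open>y\<close>, \<open>a\<close>,
    \<open>b\<close> were adjacent to \<open>y\<close>, absorbing them would give a deletable star
    with the two leaves \<open>a\<close> and \<open>b\<close>.\<close>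
  have "\<exists>t \<in> T. \<not> t \<rightarrow>\<^bsub>G\<^esub> y"
  proof (rule ccontr)
    assume "\<not> (\<exists>t \<in> T. \<not> t \<rightarrow>\<^bsub>G\<^esub> y)"
    then have "deletable_star G y ({a, b} \<union> T)"
      by (intro deletable_star_absorb) (use path in \<open>auto simp: T_def\<close>)
    then show False using no_star path(3) by blast
  qed
  then obtain t where t: "t \<in> T" "\<not> t \<rightarrow>\<^bsub>G\<^esub> y" by blast
  then have "t \<rightarrow>\<^bsub>G\<^esub> u \<longleftrightarrow> u = a \<or> u = b" for u
    using min_degree_ex_neighbour[OF deg, of t a] min_degree_ex_neighbour[OF deg, of t b]
    unfolding T_def by blast
  then show ?thesis using t unfolding T_def by blast
qed

lemma digraph_iso_cycle_graph_4:
  assumes V: "verts G = {y, a, t, b}" and dist: "distinct [y, a, t, b]"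
    and E: "arcs_ends G = {(y, a), (a, y), (a, t), (t, a), (t, b), (b, t), (b, y), (y, b)}"
  shows "digraph_iso G (cycle_graph 4)"
proof -
  define f :: "'a \<Rightarrow> nat" where
    "f v = (if v = y then 0 else if v = a then 1 else if v = t then 2 else 3)" for v
  \<comment> \<open>The arcs of \<open>cycle_graph 4\<close> are the pairs of their ends, so an arc
    is sent to its pair of numbered ends; without parallel arcs this is injective.\<close>
  define h :: "('a, 'b, nat, nat \<times> nat) digraph_isomorphism" where
    "h = \<lparr> iso_verts = f, iso_arcs = (\<lambda>e. (f (tail G e), f (head G e))),
           iso_head = snd, iso_tail = fst \<rparr>"
  have f: "f y = 0" "f a = 1" "f t = 2" "f b = 3"
    using dist by (auto simp: f_def)
  have inj: "inj_on f (verts G)"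
    by (auto simp: inj_on_def V f)
  have "inj_on (\<lambda>e. (f (tail G e), f (head G e))) (arcs G)"
    using inj no_multi_arcs unfolding inj_on_def arc_to_ends_def by simp
  then have "digraph_isomorphism h"
    using inj wf_digraph by (simp add: digraph_isomorphism_def h_def)
  moreover have "f ` verts G = {..<4}"
    by (auto simp: V f)
  moreover have "(\<lambda>e. (f (tail G e), f (head G e))) ` arcs G = map_prod f f ` arcs_ends G"
    by (auto simp: arcs_ends_conv image_image)
  moreover have "map_prod f f ` arcs_ends G =
      {(i, j). i < 4 \<and> j < 4 \<and> (j = (i + 1) mod 4 \<or> i = (j + 1) mod 4)}"
  proof -
    have less_4: "i < 4 \<longleftrightarrow> i = 0 \<or> i = 1 \<or> i = 2 \<or> i = 3" for i :: nat by arith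
    have "i < 4 \<and> j < 4 \<and> (j = (i + 1) mod 4 \<or> i = (j + 1) mod 4) \<longleftrightarrow>
        (i, j) \<in> {(0, 1), (1, 0), (1, 2), (2, 1), (2, 3), (3, 2), (3, 0), (0, 3)}" for i j :: nat
      unfolding less_4 by auto
    then show ?thesis by (simp add: E f) auto
  qed
  ultimately have "digraph_isomorphism h \<and> cycle_graph 4 = app_iso h G"
    by (simp add: app_iso_def h_def cycle_graph_def with_proj_def)
  then show ?thesis unfolding digraph_iso_def by blast
qed

text \<open>The vertex \<open>t\<close> opposite to \<open>y\<close> closes a 4-cycle. Opposite
  vertices taken at \<open>b\<close>, \<open>a\<close> and \<open>t\<close> then fix the
  neighbourhoods of \<open>a\<close>, \<open>b\<close> and \<open>y\<close>, so the cycle has no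
  chord and no edge leaves it; connectedness makes it the whole graph.\<close>

lemma no_large_star_imp_cycle_graph_4:
  assumes deg: "min_degree G \<ge> 2" and ne: "verts G \<noteq> {}"
    and conn: "\<And>u v. u \<in> verts G \<Longrightarrow> v \<in> verts G \<Longrightarrow> u \<rightarrow>\<^sup>*\<^bsub>G\<^esub> v"
    and no_star: "\<nexists>c L a b. deletable_star G c L \<and> a \<in> L \<and> b \<in> L \<and> a \<noteq> b"
  shows "digraph_iso G (cycle_graph 4)"
proof -
  note opposite = no_large_star_opposite[OF deg no_star]
  obtain y where y: "y \<in> verts G" using ne by blast
  obtain a where ya: "y \<rightarrow>\<^bsub>G\<^esub> a" using min_degree_ex_neighbour[OF deg y] by blast
  obtain b where yb: "y \<rightarrow>\<^bsub>G\<^esub> b" "a \<noteq> b" using min_degree_ex_neighbour[OF deg y, of a] by blast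
  obtain t where t: "t \<in> verts G" "t \<noteq> y" and Nt: "\<forall>u. t \<rightarrow>\<^bsub>G\<^esub> u \<longleftrightarrow> u = a \<or> u = b"
    using opposite[OF ya yb] by blast
  have Nt': "t \<rightarrow>\<^bsub>G\<^esub> a" "t \<rightarrow>\<^bsub>G\<^esub> b" by (simp_all add: Nt)
  have sides: "a \<rightarrow>\<^bsub>G\<^esub> y" "b \<rightarrow>\<^bsub>G\<^esub> y" "a \<rightarrow>\<^bsub>G\<^esub> t" "b \<rightarrow>\<^bsub>G\<^esub> t" using ya yb(1) Nt' by (simp_all add: adj_sym)
  have Na: "a \<rightarrow>\<^bsub>G\<^esub> u \<longleftrightarrow> u = y \<or> u = t" for u
  proof -
    \<comment> \<open>Here the path has centre \<open>b\<close> and ends \<open>y\<close>,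
      \<open>t\<close>. Its opposite vertex \<open>s\<close> is a neighbour of \<open>t\<close>
      other than \<open>b\<close>, hence \<open>a\<close>.\<close>
    obtain s where s: "s \<noteq> b" and Ns: "\<forall>u. s \<rightarrow>\<^bsub>G\<^esub> u \<longleftrightarrow> u = y \<or> u = t"
      using opposite[OF sides(2,4) t(2)[symmetric]] by blast
    have "s = a" using Ns[rule_format, of t] s Nt[rule_format, of s] adj_sym[of s t] by simp
    with Ns show ?thesis by simp
  qed
  have Nb: "b \<rightarrow>\<^bsub>G\<^esub> u \<longleftrightarrow> u = y \<or> u = t" for u
  proof -
    obtain s where s: "s \<noteq> a" and Ns: "\<forall>u. s \<rightarrow>\<^bsub>G\<^esub> u \<longleftrightarrow> u = y \<or> u = t"
      using opposite[OF sides(1,3) t(2)[symmetric]] by blast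
    have "s = b" using Ns[rule_format, of t] s Nt[rule_format, of s] adj_sym[of s t] by simp
    with Ns show ?thesis by simp
  qed
  have Ny: "y \<rightarrow>\<^bsub>G\<^esub> u \<longleftrightarrow> u = a \<or> u = b" for u
  proof -
    obtain s where s: "s \<noteq> t" and Ns: "\<forall>u. s \<rightarrow>\<^bsub>G\<^esub> u \<longleftrightarrow> u = a \<or> u = b"
      using opposite[OF Nt' yb(2)] by blast
    have "s = y" using Ns[rule_format, of a] s Na[of s] adj_sym[of s a] by simp
    with Ns show ?thesis by simp
  qed
  have "v \<in> {y, a, t, b}" if "y \<rightarrow>\<^sup>*\<^bsub>G\<^esub> v" for v
    using that
  proof (induction rule: reachable_induct)
    case (step x z)
    then show ?case using Ny[of z] Na[of z] Nt[rule_format, of z] Nb[of z] by auto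
  qed simp
  then have V: "verts G = {y, a, t, b}"
    using conn[OF y] y t(1) adj_in_verts(2)[OF ya] adj_in_verts(2)[OF yb(1)] by blast
  have "y \<noteq> a" "y \<noteq> b" "t \<noteq> a" "t \<noteq> b" using ya yb(1) Nt' adj_not_same by metis+
  then have dist: "distinct [y, a, t, b]" using t(2) yb(2) by auto
  have ends: "(u, v) \<in> arcs_ends G \<longleftrightarrow> (u, v) \<in> {(y, a), (a, y), (a, t), (t, a), (t, b), (b, t), (b, y), (y, b)}" for u v
  proof (cases "u \<in> verts G")
    case True
    then have "u = y \<or> u = a \<or> u = t \<or> u = b" using V by simp
    then show ?thesis
      by (elim disjE) (use dist Ny[of v] Na[of v] Nt[rule_format, of v] Nb[of v] in auto)
  next
    case False
    then have "\<not> u \<rightarrow>\<^bsub>G\<^esub> v" using adj_in_verts(1) by blast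
    then show ?thesis using False unfolding V by auto
  qed
  have "arcs_ends G = {(y, a), (a, y), (a, t), (t, a), (t, b), (b, t), (b, y), (y, b)}"
    by (simp only: set_eq_iff split_paired_All ends simp_thms)
  with V dist show ?thesis by (rule digraph_iso_cycle_graph_4)
qed

end

theorem theorem7:
  fixes G :: "('a,'b) pre_digraph"
  assumes "graph G"
    and "Digraph_Component.connected G"
    and "min_degree G \<ge> 2"
    and "\<not> digraph_iso G (cycle_graph 4)"
  shows "fractional_domatic_number G > 2"
proof -
  interpret graph G by fact
  have "strongly_connected G"
    using symmetric_connected_imp_strongly_connected[OF sym_arcs assms(2)] .
  then have ne: "verts G \<noteq> {}" and conn: "\<And>u v. u \<in> verts G \<Longrightarrow> v \<in> verts G \<Longrightarrow> u \<rightarrow>\<^sup>*\<^bsub>G\<^esub> v"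
    unfolding strongly_connected_def by auto
  obtain c L a b where "deletable_star G c L" "a \<in> L" "b \<in> L" "a \<noteq> b"
    using no_large_star_imp_cycle_graph_4[OF assms(3) ne conn] assms(4) by blast
  then have "excess_bound G (\<lambda>_. - 4)"
    using large_star_excess[OF assms(3) conn] by blast
  then obtain r where "r \<in> configuration_ratios G" "r > 2"
    using configuration_ratio_gt_2 ne by blast
  then show ?thesis
    using fractional_domatic_number_is_max(2)[OF finite_verts ne] by fastforce
qed

end
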